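(* Let $t\leq n$ be non-negative integers. The maximum size (number of member sets) of a $t$-temperate family on $[n]$ is $$\sum_{j=0}^{t} \binom{n}{\lfloor (n-t)/2\rfloor + j}.$$
   Context: For a non-negative integer $n$, $[n]=\{1,\ldots,n\}$ (with $[0]=\emptyset$), and $\mathcal{P}(X)$ denotes the power set of $X$. A family on $[n]$ is a subset $\mathcal{F}\subseteq \mathcal{P}([n])$. For a family $\mathcal{F}\subseteq\mathcal{P}([n])$ and a set $A\in\mathcal{P}([n])$, let $\mu_{\mathcal{F}}(A)=|\mathcal{P}(A)\cap\mathcal{F}|$ (the number of members of $\mathcal{F}$ that are subsets of $A$, including $A$ itself if $A\in\mathcal{F}$). For a non-negative integer $t$, $\mathcal{F}$ is called $t$-temperate if $\mu_{\mathcal{F}}(A)\leq\sum_{j=0}^t\binom{|A|}{j}$ for all $A\in\mathcal{F}$. *)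

theory Defs
  imports Complex_Main
begin

definition family_on :: "nat \<Rightarrow> nat set set \<Rightarrow> bool" where
  "family_on n F \<longleftrightarrow> F \<subseteq> Pow {1..n}"

definition mu :: "nat set set \<Rightarrow> nat set \<Rightarrow> nat" where
  "mu F A = card (Pow A \<inter> F)"

text \<open>The definition presupposes a family of finite sets, such as a family on
  \<open>{1..n}\<close>; otherwise \<^const>\<open>card\<close> takes its default value \<open>0\<close>.\<close>

definition temperate :: "nat \<Rightarrow> nat set set \<Rightarrow> bool" where
  "temperate t F \<longleftrightarrow> (\<forall>A\<in>F. mu F A \<le> (\<Sum>j=0..t. card A choose j))"

end

theory Submission
  imports Defs
begin

text \<open>
  The upper bound is an averaging argument over random chains that start at a member and grow one
  random element at a time up to the ground set \<open>V\<close> of size \<open>n\<close>. Each member \<open>B\<close> of the family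
  \<open>F\<close> sends its unit of mass to the last member of \<open>F\<close> on such a chain. If \<open>u A\<close> is the
  probability that a chain from \<open>A\<close> meets no other member, then \<open>A\<close> receives from each member
  \<open>B \<subseteq> A\<close> the mass \<open>u A / (n - b choose n - a)\<close>, where \<open>a\<close> and \<open>b\<close> are the sizes of \<open>A\<close> and
  \<open>B\<close>, because the chain from \<open>B\<close> passes through \<open>A\<close> with probability
  \<open>1 / (n - b choose n - a)\<close>. Hence \<open>card F\<close> is the total mass received.

  For fixed \<open>A\<close>, this mass does not increase with the distance \<open>a - b\<close>. Temperateness says
  that \<open>A\<close> receives from at most as many members as there are subsets of \<open>A\<close> of codimension at
  most \<open>t\<close>, so replacing the former by the latter can only increase what \<open>A\<close> receives
  (\<open>sum_le_top_layers\<close>). Since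
  \<open>(a choose i) / (n - a + i choose n - a) = (n choose a - i) / (n choose a)\<close>,
  the mass received by \<open>A\<close> is at most \<open>u A / (n choose a)\<close> times a sum of at most \<open>t + 1\<close>
  consecutive binomial coefficients, which is largest for the middle window
  (\<open>sum_layers_below_le_middle\<close>). The factors \<open>u A / (n choose a)\<close> are the
  probabilities that \<open>A\<close> is the last member on a random chain from the empty set, so they sum to at most \<open>1\<close> (\<open>chain_sum_le_1\<close>).

  The bound is attained by the middle \<open>t + 1\<close> layers: there, the members below \<open>A\<close> are
  among its subsets of codimension at most \<open>t\<close>.
\<close>

section \<open>Random chains\<close>

text \<open>The reciprocal of the binomial coefficient is the probability that a uniformly random
  maximal chain from \<open>B\<close> to \<open>V\<close> contains \<open>A\<close>. With \<open>u A\<close> the probability that a chain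
  through \<open>A\<close> meets no member of \<open>F\<close> strictly above \<open>A\<close>, the sum is the probability that the chain meets \<open>F\<close> at all,
  split according to its last member.\<close>

definition chain_sum :: "'a set \<Rightarrow> 'a set set \<Rightarrow> ('a set \<Rightarrow> real) \<Rightarrow> 'a set \<Rightarrow> real" where
  "chain_sum V F u B = (\<Sum>A | A \<in> F \<and> B \<subseteq> A. u A / real (card (V - B) choose card (V - A)))"

text \<open>The first step of a random chain from \<open>B\<close> adds a uniformly random element of \<open>V - B\<close>. As an
  identity, it holds for arbitrary \<open>u\<close>: a set \<open>A \<supset> B\<close> is counted once for each of the
  \<open>card (A - B)\<close> first steps that stay inside \<open>A\<close>, and the absorption identity for binomial
  coefficients compensates for the shorter chain.\<close>

lemma chain_sum_average:
  assumes V: "finite V" and F: "F \<subseteq> Pow V" and B: "B \<subseteq> V" "B \<notin> F"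
  shows "card (V - B) * chain_sum V F u B = (\<Sum>x\<in>V - B. chain_sum V F u (insert x B))"
proof -
  have finF: "finite F" using V F by (meson finite_Pow_iff finite_subset)
  define m where "m = card (V - B)"
  have "(\<Sum>x\<in>V - B. chain_sum V F u (insert x B))
      = (\<Sum>x\<in>V - B. \<Sum>A | A \<in> F \<and> insert x B \<subseteq> A. u A / real ((m - 1) choose card (V - A)))"
  proof (rule sum.cong[OF refl])
    fix x assume "x \<in> V - B"
    moreover have "V - insert x B = (V - B) - {x}" by blast
    ultimately have "card (V - insert x B) = m - 1"
      by (simp only: m_def card_Diff_singleton)
    then show "chain_sum V F u (insert x B)
        = (\<Sum>A | A \<in> F \<and> insert x B \<subseteq> A. u A / real ((m - 1) choose card (V - A)))"
      by (simp add: chain_sum_def)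
  qed
  also have "\<dots> = (\<Sum>A\<in>F. \<Sum>x | x \<in> V - B \<and> insert x B \<subseteq> A.
      u A / real ((m - 1) choose card (V - A)))"
    using V finF by (intro sum.swap_restrict) auto
  also have "\<dots> = (\<Sum>A\<in>F. if B \<subseteq> A then card (A - B) * (u A / real ((m - 1) choose card (V - A))) else 0)"
  proof (rule sum.cong[OF refl])
    fix A assume "A \<in> F"
    then have "{x. x \<in> V - B \<and> insert x B \<subseteq> A} = (if B \<subseteq> A then A - B else {})" using F by auto
    then show "(\<Sum>x | x \<in> V - B \<and> insert x B \<subseteq> A. u A / real ((m - 1) choose card (V - A)))
       = (if B \<subseteq> A then card (A - B) * (u A / real ((m - 1) choose card (V - A))) else 0)"
      by simp
  qed
  also have "\<dots> = (\<Sum>A\<in>F. if B \<subseteq> A then m * (u A / real (m choose card (V - A))) else 0)"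
  proof (rule sum.cong[OF refl])
    fix A assume A: "A \<in> F"
    have "card (A - B) * (u A / real ((m - 1) choose card (V - A))) = m * (u A / real (m choose card (V - A)))"
      if "B \<subseteq> A"
    proof -
      have finA: "finite A" using A F V finite_subset by blast
      have "V - B = (V - A) \<union> (A - B)" "(V - A) \<inter> (A - B) = {}" using A F that by auto
      then have m: "m = card (V - A) + card (A - B)"
        using V finA by (simp add: m_def card_Un_disjoint)
      have "A - B \<noteq> {}" using A B that by auto
      then have "card (A - B) \<noteq> 0" using finA by simp
      with m have lt: "card (V - A) \<le> m - 1" "m > 0" by auto
      have "card (A - B) * (m choose card (V - A)) = m * ((m - 1) choose card (V - A))"
        using binomial_absorb_comp[of m "card (V - A)"] m by simp
      then have "real (card (A - B)) * real (m choose card (V - A)) = real m * real ((m - 1) choose card (V - A))"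
        by (simp only: flip: of_nat_mult)
      moreover have "(m choose card (V - A)) > 0" "((m - 1) choose card (V - A)) > 0"
        using lt by auto
      ultimately show ?thesis by (simp add: field_simps)
    qed
    then show "(if B \<subseteq> A then card (A - B) * (u A / real ((m - 1) choose card (V - A))) else 0)
        = (if B \<subseteq> A then m * (u A / real (m choose card (V - A))) else 0)"
      by simp
  qed
  also have "\<dots> = m * chain_sum V F u B"
    using finF by (simp add: chain_sum_def m_def sum_distrib_left sum.inter_filter if_distrib cong: if_cong)
  finally show ?thesis by (simp add: m_def)
qed

text \<open>Away from \<open>F\<close> the chain sums satisfy the mean value property above, so an upper bound on \<open>F\<close>
  (and at \<open>V\<close>, where the sum is empty unless \<open>V \<in> F\<close>) propagates downwards from \<open>V\<close>.\<close>

lemma chain_sum_le_1: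
  assumes V: "finite V" and F: "F \<subseteq> Pow V" and one: "\<And>A. A \<in> F \<Longrightarrow> chain_sum V F u A = 1"
  shows "B \<subseteq> V \<Longrightarrow> chain_sum V F u B \<le> 1"
proof (induction "card (V - B)" arbitrary: B rule: less_induct)
  case less
  consider "B \<in> F" | "B \<notin> F" "B = V" | "B \<notin> F" "B \<noteq> V" by blast
  then show ?case
  proof cases
    case 1
    then show ?thesis using one by simp
  next
    case 2
    then have none: "{A. A \<in> F \<and> B \<subseteq> A} = {}" using F by auto
    show ?thesis unfolding chain_sum_def none by simp
  next
    case 3
    then have pos: "card (V - B) > 0" using V less.prems by (auto simp: card_gt_0_iff)
    have "card (V - B) * chain_sum V F u B = (\<Sum>x\<in>V - B. chain_sum V F u (insert x B))"
      using chain_sum_average V F less.prems 3 by blast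
    also have "\<dots> \<le> (\<Sum>x\<in>V - B. 1)"
    proof (rule sum_mono)
      fix x assume "x \<in> V - B"
      then show "chain_sum V F u (insert x B) \<le> 1"
        using V less.prems by (intro less.hyps psubset_card_mono) auto
    qed
    finally show ?thesis using pos by simp
  qed
qed

text \<open>The escape probability at \<open>A\<close> is determined by those at the members strictly above \<open>A\<close>, through
  the requirement that a chain from \<open>A\<close> meets \<open>F\<close> with probability \<open>1\<close>. It is therefore built
  by inserting the members by decreasing size; it stays nonnegative because the chain sum at \<open>A\<close>
  of the members inserted earlier is at most \<open>1\<close>.\<close>

lemma escape_probabilities:
  assumes V: "finite V" and F: "F \<subseteq> Pow V"
  obtains u where "\<And>A. A \<in> F \<Longrightarrow> u A \<ge> 0" and "\<And>B. B \<in> F \<Longrightarrow> chain_sum V F u B = 1"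
proof -
  have "finite F" using V F by (meson finite_Pow_iff finite_subset)
  then have "F \<subseteq> Pow V \<Longrightarrow> \<exists>u. (\<forall>A\<in>F. u A \<ge> 0) \<and> (\<forall>B\<in>F. chain_sum V F u B = 1)"
  proof (induction rule: finite_ranking_induct[where f = "\<lambda>A. card (V - A)"])
    case empty
    then show ?case by simp
  next
    case (insert A F)
    show ?case
    proof (cases "A \<in> F")
      case True
      then show ?thesis using insert by (simp add: insert_absorb)
    next
      case False
      have AV: "A \<subseteq> V" and FV: "F \<subseteq> Pow V" using insert.prems by auto
      obtain u where u: "\<forall>A\<in>F. u A \<ge> 0" "\<forall>B\<in>F. chain_sum V F u B = 1"
        using insert.IH[OF FV] by blast
      define v where "v = u(A := 1 - chain_sum V F u A)"
      have "chain_sum V F u A \<le> 1"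
        by (rule chain_sum_le_1[OF V FV _ AV]) (simp add: u(2))
      then have nonneg: "v A \<ge> 0" by (simp add: v_def)
      have "chain_sum V (insert A F) v B = 1" if B: "B \<in> F" for B
      proof -
        have "\<not> B \<subseteq> A"
        proof
          assume "B \<subseteq> A"
          moreover have "B \<noteq> A" using B False by auto
          ultimately have "V - A \<subset> V - B" using AV by auto
          then have "card (V - A) < card (V - B)" using V by (intro psubset_card_mono) simp_all
          with insert.hyps(2)[OF B] show False by linarith
        qed
        then have "{C. C \<in> insert A F \<and> B \<subseteq> C} = {C. C \<in> F \<and> B \<subseteq> C}" by auto
        then have "chain_sum V (insert A F) v B = chain_sum V F u B"
          unfolding chain_sum_def v_def using False by (auto intro!: sum.cong)
        then show ?thesis using u B by simp
      qed
      moreover have "chain_sum V (insert A F) v A = 1"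
      proof -
        have "{C. C \<in> insert A F \<and> A \<subseteq> C} = insert A {C. C \<in> F \<and> A \<subseteq> C}" by auto
        then have "chain_sum V (insert A F) v A = v A + chain_sum V F v A"
          unfolding chain_sum_def using False insert.hyps by simp
        moreover have "chain_sum V F v A = chain_sum V F u A"
          unfolding chain_sum_def v_def using False by (auto intro!: sum.cong)
        ultimately show ?thesis by (simp add: v_def)
      qed
      moreover have "v B \<ge> 0" if "B \<in> F" for B
        using that u(1) False by (auto simp: v_def)
      ultimately show ?thesis using nonneg by (intro exI[of _ v]) auto
    qed
  qed
  then show ?thesis using that F by blast
qed

section \<open>Sets below a given set\<close>

lemma card_subsets_by_codim:
  assumes "finite A"
  shows "card {B. B \<subseteq> A \<and> card (A - B) = i} = card A choose i"
proof -
  have "bij_betw (\<lambda>B. A - B) {B. B \<subseteq> A \<and> card (A - B) = i} {C. C \<subseteq> A \<and> card C = i}"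
    by (rule bij_betw_byWitness[where f' = "\<lambda>B. A - B"])
      (auto simp: Diff_Diff_Int Int_absorb1)
  then show ?thesis using n_subsets[OF assms, of i] bij_betw_same_card by fastforce
qed

lemma sum_subsets_by_codim:
  fixes h :: "nat \<Rightarrow> real"
  assumes "finite A"
  shows "(\<Sum>B | B \<subseteq> A \<and> card (A - B) \<le> t. h (card (A - B))) = (\<Sum>i=0..t. real (card A choose i) * h i)"
proof -
  have "(\<Sum>B | B \<subseteq> A \<and> card (A - B) \<le> t. h (card (A - B)))
      = (\<Sum>i=0..t. \<Sum>B | B \<in> {B. B \<subseteq> A \<and> card (A - B) \<le> t} \<and> card (A - B) = i. h (card (A - B)))"
    using assms by (intro sum.group[symmetric]) auto
  also have "\<dots> = (\<Sum>i=0..t. real (card A choose i) * h i)"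
  proof (rule sum.cong[OF refl])
    fix i assume "i \<in> {0..t}"
    then have "{B. B \<in> {B. B \<subseteq> A \<and> card (A - B) \<le> t} \<and> card (A - B) = i} = {B. B \<subseteq> A \<and> card (A - B) = i}"
      by auto
    then show "(\<Sum>B | B \<in> {B. B \<subseteq> A \<and> card (A - B) \<le> t} \<and> card (A - B) = i. h (card (A - B)))
        = real (card A choose i) * h i"
      using card_subsets_by_codim[OF assms, of i] by simp
  qed
  finally show ?thesis .
qed

text \<open>The top \<open>t + 1\<close> layers of \<open>Pow A\<close> carry the largest weights and contain at least as many sets
  as \<open>S\<close>. Subtracting the threshold \<open>g t\<close> makes the comparison termwise: the excess over \<open>g t\<close> is
  nonnegative on these layers and at most \<open>0\<close> below them, while the threshold itself is
  paid for by counting.\<close>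

lemma sum_le_top_layers:
  fixes g :: "nat \<Rightarrow> real"
  assumes A: "finite A" and S: "S \<subseteq> Pow A" and card: "card S \<le> (\<Sum>i=0..t. card A choose i)"
    and g: "antimono g" "\<And>i. g i \<ge> 0"
  shows "(\<Sum>B\<in>S. g (card (A - B))) \<le> (\<Sum>i=0..t. real (card A choose i) * g i)"
proof -
  have excess: "max 0 (g c - g t) = (if c \<le> t then g c - g t else 0)" for c
    using antimonoD[OF g(1), of c t] antimonoD[OF g(1), of t c] by auto
  have "(\<Sum>B\<in>S. g (card (A - B)) - g t) \<le> (\<Sum>B\<in>S. max 0 (g (card (A - B)) - g t))"
    by (intro sum_mono) simp
  also have "\<dots> \<le> (\<Sum>B\<in>Pow A. max 0 (g (card (A - B)) - g t))"
    using A S by (intro sum_mono2) auto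
  also have "\<dots> = (\<Sum>B | B \<subseteq> A \<and> card (A - B) \<le> t. g (card (A - B)) - g t)"
    using A by (intro sum.mono_neutral_cong_right) (auto simp: excess)
  also have "\<dots> = (\<Sum>i=0..t. real (card A choose i) * (g i - g t))"
    by (rule sum_subsets_by_codim[OF A, where h = "\<lambda>i. g i - g t"])
  finally have "(\<Sum>B\<in>S. g (card (A - B)))
      \<le> card S * g t + (\<Sum>i=0..t. real (card A choose i) * (g i - g t))"
    by (simp add: sum_subtractf)
  also have "card S * g t \<le> real (\<Sum>i=0..t. card A choose i) * g t"
    using card g(2) by (intro mult_right_mono) (simp_all only: of_nat_le_iff)
  finally show ?thesis
    by (simp add: right_diff_distrib sum_subtractf sum_distrib_right)
qed

section \<open>Windows of consecutive binomial coefficients\<close>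

lemma binomial_window_step:
  fixes n t s :: nat
  shows "(\<Sum>j=0..t. n choose (Suc s + j)) + (n choose s) = (\<Sum>j=0..t. n choose (s + j)) + (n choose (Suc s + t))"
proof -
  have "(\<Sum>j=0..Suc t. n choose (s + j)) = (n choose s) + (\<Sum>j=0..t. n choose (Suc s + j))"
    by (subst sum.atLeast0_atMost_Suc_shift) simp
  then show ?thesis by simp
qed

text \<open>Shifting the window from \<open>s\<close> to \<open>s + 1\<close> trades \<open>n choose s\<close> for \<open>n choose (s + t + 1)\<close>. By
  unimodality this is no loss while \<open>s + t + 1 \<le> n - s\<close> and no gain once
  \<open>s + t + 1 \<ge> n - s\<close>, so the window sums rise up to \<open>(n - t) div 2\<close> and fall
  afterwards.\<close>

lemma binomial_window_le_middle:
  fixes n t s :: nat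
  assumes "t \<le> n"
  shows "(\<Sum>j=0..t. n choose (s + j)) \<le> (\<Sum>j=0..t. n choose ((n - t) div 2 + j))"
proof -
  define m where "m = (n - t) div 2"
  define w where "w s = (\<Sum>j=0..t. n choose (s + j))" for s
  have up: "w s \<le> w (Suc s)" if "s < m" for s
  proof -
    have "2 * s + t + 2 \<le> n" using that assms unfolding m_def by linarith
    then have "n choose s \<le> n choose (Suc s + t)"
    proof (cases "2 * (Suc s + t) \<le> n")
      case True
      then show ?thesis by (intro binomial_mono) auto
    next
      case False
      have "n choose s \<le> n choose (n - (Suc s + t))"
        using \<open>2 * s + t + 2 \<le> n\<close> False by (intro binomial_mono) auto
      then show ?thesis using \<open>2 * s + t + 2 \<le> n\<close> binomial_symmetric[of "Suc s + t" n] by simp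
    qed
    then show ?thesis using binomial_window_step[where n=n and t=t and s=s] unfolding w_def by linarith
  qed
  have down: "w (Suc s) \<le> w s" if "s \<ge> m" for s
  proof -
    have *: "2 * s + t + 1 \<ge> n" using that assms unfolding m_def by linarith
    have "n choose (Suc s + t) \<le> n choose s"
    proof (cases "Suc s + t \<le> n")
      case le: True
      show ?thesis
      proof (cases "n div 2 \<le> s")
        case True
        then show ?thesis using le by (intro binomial_antimono) auto
      next
        case False
        have "n choose (n - (Suc s + t)) \<le> n choose s"
          using * False by (intro binomial_mono) auto
        then show ?thesis using le binomial_symmetric[of "Suc s + t" n] by simp
      qed
    qed (simp add: binomial_eq_0)
    then show ?thesis using binomial_window_step[where n=n and t=t and s=s] unfolding w_def by linarith
  qed
  have "w s \<le> w m"
  proof (cases "s \<le> m")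
    case True
    then show ?thesis by (induction rule: inc_induct) (use up order_trans in blast)+
  next
    case False
    then have "m \<le> s" by simp
    then show ?thesis by (induction rule: dec_induct) (use down order_trans in blast)+
  qed
  then show ?thesis by (simp add: w_def m_def)
qed

lemma sum_layers_below_le_middle:
  fixes n t a :: nat
  assumes "t \<le> n"
  shows "(\<Sum>i | i \<le> t \<and> i \<le> a. n choose (a - i)) \<le> (\<Sum>j=0..t. n choose ((n - t) div 2 + j))"
proof -
  have "(\<Sum>i | i \<le> t \<and> i \<le> a. n choose (a - i)) = (\<Sum>k\<in>{a - t..a}. n choose k)"
    by (rule sum.reindex_bij_witness[of _ "\<lambda>k. a - k" "\<lambda>i. a - i"]) auto
  also have "\<dots> \<le> (\<Sum>k\<in>{a - t..a - t + t}. n choose k)"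
    by (intro sum_mono2) auto
  also have "\<dots> = (\<Sum>j=0..t. n choose (a - t + j))"
    using sum.shift_bounds_cl_nat_ivl[of "\<lambda>k. n choose k" 0 "a - t" t] by (simp add: add.commute)
  also have "\<dots> \<le> (\<Sum>j=0..t. n choose ((n - t) div 2 + j))"
    by (rule binomial_window_le_middle[OF assms])
  finally show ?thesis .
qed

section \<open>The bound and the extremal family\<close>

text \<open>The mass-transport argument: double counting of the mass sent from \<open>B\<close> to \<open>A\<close>, with
  \<open>below\<close> bounding what one member \<open>A\<close> receives, up to the factor \<open>u A\<close>.\<close>

lemma temperate_card_le:
  fixes V :: "'a set"
  assumes V: "finite V" and F: "F \<subseteq> Pow V" and t: "t \<le> card V"
    and temp: "\<And>A. A \<in> F \<Longrightarrow> card (Pow A \<inter> F) \<le> (\<Sum>j=0..t. card A choose j)"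
  shows "card F \<le> (\<Sum>j=0..t. card V choose ((card V - t) div 2 + j))"
proof -
  let ?n = "card V"
  let ?M = "\<Sum>j=0..t. ?n choose ((?n - t) div 2 + j)"
  obtain u where u: "\<And>A. A \<in> F \<Longrightarrow> u A \<ge> 0" "\<And>B. B \<in> F \<Longrightarrow> chain_sum V F u B = 1"
    using escape_probabilities[OF V F] by blast
  have finF: "finite F" using V F by (meson finite_Pow_iff finite_subset)
  have below: "(\<Sum>B\<in>Pow A \<inter> F. 1 / real (card (V - B) choose card (V - A))) \<le> ?M / (?n choose card (V - A))"
    if A: "A \<in> F" for A
  proof -
    let ?a = "card A" and ?c = "card (V - A)"
    define g where "g i = 1 / real (?c + i choose ?c)" for i
    have "A \<subseteq> V" using A F by blast
    then have AV: "A \<subseteq> V" "finite A" using V finite_subset by blast+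
    have n: "?n = ?c + ?a" using AV V by (simp add: card_Diff_subset card_mono)
    have "(\<Sum>B\<in>Pow A \<inter> F. 1 / real (card (V - B) choose ?c)) = (\<Sum>B\<in>Pow A \<inter> F. g (card (A - B)))"
    proof (rule sum.cong[OF refl])
      fix B assume "B \<in> Pow A \<inter> F"
      then have "V - B = (V - A) \<union> (A - B)" "(V - A) \<inter> (A - B) = {}" using AV by auto
      then have "card (V - B) = ?c + card (A - B)"
        using V AV by (simp add: card_Un_disjoint)
      then show "1 / real (card (V - B) choose ?c) = g (card (A - B))" by (simp add: g_def)
    qed
    also have "\<dots> \<le> (\<Sum>i=0..t. real (?a choose i) * g i)"
    proof (rule sum_le_top_layers)
      show "antimono g"
        unfolding g_def by (intro antimonoI divide_left_mono) (auto intro: binomial_right_mono)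
    qed (use AV temp[OF A] in \<open>auto simp: g_def\<close>)
    also have "\<dots> = (\<Sum>i | i \<le> t \<and> i \<le> ?a. real (?a choose i) * g i)"
      by (intro sum.mono_neutral_right) auto
    also have "\<dots> = (\<Sum>i | i \<le> t \<and> i \<le> ?a. real (?n choose (?a - i)) / real (?n choose ?c))"
    proof (rule sum.cong[OF refl])
      fix i assume i: "i \<in> {i. i \<le> t \<and> i \<le> ?a}"
      have "(?n choose (?c + i)) * (?c + i choose ?c) = (?n choose ?c) * (?a choose i)"
        using choose_mult[of ?c "?c + i" ?n] n i by simp
      moreover have "?n choose (?c + i) = ?n choose (?a - i)"
        using binomial_symmetric[of "?c + i" ?n] n i by simp
      ultimately have "real (?n choose (?a - i)) * real (?c + i choose ?c) = real (?n choose ?c) * real (?a choose i)"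
        by (simp only: flip: of_nat_mult)
      moreover have "(?n choose ?c) > 0" "(?c + i choose ?c) > 0" using n by auto
      ultimately show "real (?a choose i) * g i = real (?n choose (?a - i)) / real (?n choose ?c)"
        by (simp add: g_def field_simps)
    qed
    also have "\<dots> = real (\<Sum>i | i \<le> t \<and> i \<le> ?a. ?n choose (?a - i)) / real (?n choose ?c)"
      by (simp add: sum_divide_distrib)
    also have "\<dots> \<le> ?M / (?n choose ?c)"
      by (intro divide_right_mono of_nat_mono sum_layers_below_le_middle[OF t]) simp
    finally show ?thesis .
  qed
  have collect: "(\<Sum>A\<in>F. u A * (M / (?n choose card (V - A)))) = M * chain_sum V F u {}" for M
    by (simp add: chain_sum_def sum_distrib_left mult.commute)
  have "real (card F) = (\<Sum>B\<in>F. chain_sum V F u B)" using u by simp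
  also have "\<dots> = (\<Sum>A\<in>F. \<Sum>B | B \<in> F \<and> B \<subseteq> A. u A / real (card (V - B) choose card (V - A)))"
    unfolding chain_sum_def using finF by (intro sum.swap_restrict) auto
  also have "\<dots> = (\<Sum>A\<in>F. u A * (\<Sum>B\<in>Pow A \<inter> F. 1 / real (card (V - B) choose card (V - A))))"
    by (auto simp: sum_distrib_left Pow_def Int_def conj_commute intro!: sum.cong)
  also have "\<dots> \<le> (\<Sum>A\<in>F. u A * (?M / (?n choose card (V - A))))"
    by (intro sum_mono mult_left_mono below u)
  also have "\<dots> = ?M * chain_sum V F u {}"
    by (rule collect)
  also have "\<dots> \<le> real ?M * 1"
    by (intro mult_left_mono chain_sum_le_1[OF V F u(2)] of_nat_0_le_iff) simp_all
  finally show ?thesis by (simp only: mult_1_right of_nat_le_iff)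
qed

definition layers :: "'a set \<Rightarrow> nat \<Rightarrow> nat \<Rightarrow> 'a set set" where
  "layers V l t = {A. A \<subseteq> V \<and> l \<le> card A \<and> card A \<le> l + t}"

lemma card_layers:
  assumes "finite V"
  shows "card (layers V l t) = (\<Sum>j=0..t. card V choose (l + j))"
proof -
  have "layers V l t = (\<Union>j\<in>{0..t}. {A. A \<subseteq> V \<and> card A = l + j})"
  proof (intro equalityI subsetI)
    fix A assume "A \<in> layers V l t"
    then have "A \<subseteq> V" "card A - l \<in> {0..t}" "card A = l + (card A - l)"
      by (auto simp: layers_def)
    then show "A \<in> (\<Union>j\<in>{0..t}. {A. A \<subseteq> V \<and> card A = l + j})" by blast
  qed (auto simp: layers_def)
  also have "card \<dots> = (\<Sum>j=0..t. card {A. A \<subseteq> V \<and> card A = l + j})"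
    using assms by (intro card_UN_disjoint) auto
  finally show ?thesis using assms by (simp add: n_subsets)
qed

lemma layers_temperate:
  assumes "finite V" "A \<in> layers V l t"
  shows "card (Pow A \<inter> layers V l t) \<le> (\<Sum>j=0..t. card A choose j)"
proof -
  have "A \<subseteq> V" using assms(2) by (simp add: layers_def)
  then have A: "finite A" using assms(1) by (rule finite_subset)
  have "Pow A \<inter> layers V l t \<subseteq> {B. B \<subseteq> A \<and> card (A - B) \<le> t}"
  proof
    fix B assume B: "B \<in> Pow A \<inter> layers V l t"
    then have "card (A - B) = card A - card B"
      using A by (auto intro: card_Diff_subset finite_subset)
    then show "B \<in> {B. B \<subseteq> A \<and> card (A - B) \<le> t}"
      using B assms(2) by (auto simp: layers_def)
  qed
  then have "card (Pow A \<inter> layers V l t) \<le> card {B. B \<subseteq> A \<and> card (A - B) \<le> t}"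
    using A by (intro card_mono) auto
  also have "\<dots> = (\<Sum>j=0..t. card A choose j)"
    using sum_subsets_by_codim[OF A, where t = t and h = "\<lambda>_. 1"] by (simp flip: of_nat_sum)
  finally show ?thesis .
qed

theorem theorem1p3:
  fixes t n :: nat
  assumes "t \<le> n"
  shows "Max {card F | F. family_on n F \<and> temperate t F}
    = (\<Sum>j=0..t. n choose ((n - t) div 2 + j))"
proof (rule Max_eqI)
  have "{card F | F. family_on n F \<and> temperate t F} \<subseteq> card ` Pow (Pow {1..n})"
    by (auto simp: family_on_def)
  then show "finite {card F | F. family_on n F \<and> temperate t F}"
    by (rule finite_subset) simp
next
  fix y assume "y \<in> {card F | F. family_on n F \<and> temperate t F}"
  then show "y \<le> (\<Sum>j=0..t. n choose ((n - t) div 2 + j))"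
    using temperate_card_le[of "{1..n}" _ t] assms
    by (auto simp: family_on_def temperate_def mu_def)
next
  let ?F = "layers {1..n} ((n - t) div 2) t"
  have "family_on n ?F" by (auto simp: family_on_def layers_def)
  moreover have "temperate t ?F"
    unfolding temperate_def mu_def using layers_temperate[of "{1..n}"] by blast
  moreover have "card ?F = (\<Sum>j=0..t. n choose ((n - t) div 2 + j))"
    by (simp add: card_layers)
  ultimately show "(\<Sum>j=0..t. n choose ((n - t) div 2 + j)) \<in> {card F | F. family_on n F \<and> temperate t F}"
    by (metis (mono_tags, lifting) mem_Collect_eq)
qed

end
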